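(* Let $(X,\mathcal{M})$ be a metrizable $m$-complete multi-normed vector lattice (MNVL). Then the following conditions are equivalent: (i) $X$ has a countable topological orthogonal system; (ii) the $um$-topology on $X$ is metrizable; (iii) $X$ has a quasi-interior point.
   Context: A multi-normed vector lattice (MNVL) $(X,\mathcal{M})$ is a real vector lattice $X$ together with a separating, upward directed family $\mathcal{M}=\{m_\lambda\}_{\lambda\in\Lambda}$ of lattice seminorms on $X$ (seminorms with $|x|\le|y|\Rightarrow m_\lambda(x)\le m_\lambda(y)$). The $m$-topology is the Hausdorff locally convex-solid topology generated by $\mathcal{M}$; a net $x_\alpha$ $m$-converges to $x$ ($x_\alpha\xrightarrow{m}x$) iff $m_\lambda(x_\alpha-x)\to0$ for every $\lambda\in\Lambda$. "$m$-complete" means complete in the $m$-topology, and "metrizable MNVL" means the $m$-topology is metrizable. A net $x_\alpha$ in $X$ is $um$-convergent to $x$ ($x_\alpha\xrightarrow{um}x$) if $|x_\alpha-x|\wedge u\xrightarrow{m}0$ for every $u\in X_+$. This is convergence with respect to a Hausdorff locally solid linear topology, the $um$-topology, which has a base of neighborhoods at zero consisting of the sets $\{x\in X: m_\lambda(|x|\wedge u)<\varepsilon\}$, $\varepsilon>0$, $0\ne u\in X_+$, $\lambda\in\Lambda$. An orthogonal system in $X$ is a collection $\{e_\gamma\}_{\gamma\in\Gamma}$ of positive vectors with $e_\gamma\wedge e_{\gamma'}=0$ for $\gamma\ne\gamma'$. An orthogonal system $Q$ of non-zero elements of $X_+$ is a topological orthogonal system if the (order) ideal $I_Q$ generated by $Q$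 is dense in $X$ for the $m$-topology. Countable means finite or countably infinite. An element $0\ne e\in X_+$ is a quasi-interior point if the principal ideal $I_e$ is dense in $X$ for the $m$-topology. *)

theory Defs
  imports "HOL-Analysis.Analysis" "HOL-Library.Lattice_Algebras"
begin

class vector_lattice = ordered_real_vector + lattice_ab_group_add_abs

definition lattice_seminorm :: "('a::vector_lattice \<Rightarrow> real) \<Rightarrow> bool" where
  "lattice_seminorm m \<longleftrightarrow>
     (\<forall>x y. m (x + y) \<le> m x + m y) \<and>
     (\<forall>c x. m (c *\<^sub>R x) = \<bar>c\<bar> * m x) \<and>
     (\<forall>x y. \<bar>x\<bar> \<le> \<bar>y\<bar> \<longrightarrow> m x \<le> m y)"

text \<open>Upward directedness includes that the family is nonempty.\<close>

definition mnvl :: "('a::vector_lattice \<Rightarrow> real) set \<Rightarrow> bool" where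
  "mnvl M \<longleftrightarrow>
     (\<forall>m\<in>M. lattice_seminorm m) \<and>
     (\<forall>x. x \<noteq> 0 \<longrightarrow> (\<exists>m\<in>M. m x \<noteq> 0)) \<and>
     M \<noteq> {} \<and> (\<forall>m1\<in>M. \<forall>m2\<in>M. \<exists>m\<in>M. \<forall>x. m1 x \<le> m x \<and> m2 x \<le> m x)"

definition m_topology :: "('a::vector_lattice \<Rightarrow> real) set \<Rightarrow> 'a topology" where
  "m_topology M = topology_generated_by {{y. m (y - x) < \<epsilon>} | m x \<epsilon>. m \<in> M \<and> 0 < \<epsilon>}"

text \<open>Completeness of a linear topology with respect to its translation-invariant
  uniformity; proper filters take the place of nets.\<close>

definition complete_linear_topology :: "'a::real_vector topology \<Rightarrow> bool" where
  "complete_linear_topology T \<longleftrightarrow>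
     (\<forall>F. F \<noteq> bot \<and>
          (\<forall>U. openin T U \<and> 0 \<in> U \<longrightarrow> (\<forall>\<^sub>F (x, y) in F \<times>\<^sub>F F. x - y \<in> U)) \<longrightarrow>
        (\<exists>l. limitin T (\<lambda>x. x) l F))"

definition um_base :: "('a::vector_lattice \<Rightarrow> real) set \<Rightarrow> 'a set set" where
  "um_base M = {{x. m (inf \<bar>x\<bar> u) < \<epsilon>} | m u \<epsilon>. m \<in> M \<and> 0 \<le> u \<and> u \<noteq> 0 \<and> 0 < \<epsilon>}"

text \<open>This is a topology only because \<open>M\<close> is directed (see \<open>openin_um_topology\<close>), and it
  induces exactly um-convergence (see \<open>limitin_um_topology\<close>).\<close>

definition um_topology :: "('a::vector_lattice \<Rightarrow> real) set \<Rightarrow> 'a topology" where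
  "um_topology M = topology (\<lambda>U. \<forall>x\<in>U. \<exists>V\<in>um_base M. (\<lambda>v. x + v) ` V \<subseteq> U)"

definition order_ideal :: "'a::vector_lattice set \<Rightarrow> bool" where
  "order_ideal I \<longleftrightarrow> subspace I \<and> (\<forall>x\<in>I. \<forall>y. \<bar>y\<bar> \<le> \<bar>x\<bar> \<longrightarrow> y \<in> I)"

definition orthogonal_system :: "'a::vector_lattice set \<Rightarrow> bool" where
  "orthogonal_system Q \<longleftrightarrow> (\<forall>e\<in>Q. 0 \<le> e) \<and> pairwise (\<lambda>e e'. inf e e' = 0) Q"

definition topological_orthogonal_system ::
    "('a::vector_lattice \<Rightarrow> real) set \<Rightarrow> 'a set \<Rightarrow> bool" where
  "topological_orthogonal_system M Q \<longleftrightarrow>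
     orthogonal_system Q \<and> 0 \<notin> Q \<and> m_topology M closure_of (order_ideal hull Q) = UNIV"

definition quasi_interior_point :: "('a::vector_lattice \<Rightarrow> real) set \<Rightarrow> 'a \<Rightarrow> bool" where
  "quasi_interior_point M e \<longleftrightarrow>
     e \<noteq> 0 \<and> 0 \<le> e \<and> m_topology M closure_of (order_ideal hull {e}) = UNIV"

lemma order_ideal_hull: "order_ideal (order_ideal hull Q)"
  by (rule hull_in) (auto simp: order_ideal_def subspace_def)

lemma lattice_seminorm_nonneg:
  assumes "lattice_seminorm m" shows "0 \<le> m x"
proof -
  have "m (0 *\<^sub>R x) = \<bar>0\<bar> * m x" using assms unfolding lattice_seminorm_def by blast
  then have "m 0 = 0" by simp
  moreover have "m 0 \<le> m x" using assms unfolding lattice_seminorm_def by simp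
  ultimately show ?thesis by simp
qed

lemma inf_add_le:
  fixes a b u :: "'a::vector_lattice"
  assumes "0 \<le> a" "0 \<le> b" "0 \<le> u"
  shows "inf (a + b) u \<le> inf a u + inf b u"
proof -
  have "inf (a + b) u \<le> a + b" "inf (a + b) u \<le> u" by auto
  moreover have "u \<le> u + b" "u \<le> a + u" "u \<le> u + u" using assms by auto
  ultimately have "inf (a + b) u \<le> inf (inf (a + b) (u + b)) (inf (a + u) (u + u))"
    by (meson le_inf_iff order_trans)
  also have "\<dots> = inf a u + inf b u"
    by (simp add: add_inf_distrib_left add_inf_distrib_right inf.assoc)
  finally show ?thesis .
qed

lemma um_seminorm_triangle:
  fixes x y u :: "'a::vector_lattice"
  assumes "lattice_seminorm m" "0 \<le> u"
  shows "m (inf \<bar>x + y\<bar> u) \<le> m (inf \<bar>x\<bar> u) + m (inf \<bar>y\<bar> u)"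
proof -
  have "inf \<bar>x + y\<bar> u \<le> inf (\<bar>x\<bar> + \<bar>y\<bar>) u"
    by (rule inf_mono) (auto simp: abs_triangle_ineq)
  also have "\<dots> \<le> inf (abs x) u + inf (abs y) u" using assms by (intro inf_add_le) auto
  finally have "abs (inf (abs (x + y)) u) \<le> abs (inf (abs x) u + inf (abs y) u)"
    using assms(2) by simp
  then show ?thesis using assms(1) unfolding lattice_seminorm_def by (meson order_trans)
qed

lemma um_baseI:
  "m \<in> M \<Longrightarrow> 0 \<le> u \<Longrightarrow> u \<noteq> 0 \<Longrightarrow> 0 < e \<Longrightarrow> {x. m (inf \<bar>x\<bar> u) < e} \<in> um_base M"
  unfolding um_base_def by blast

lemma openin_um_topology:
  fixes M :: "('a::vector_lattice \<Rightarrow> real) set"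
  assumes "mnvl M"
  shows "openin (um_topology M) U \<longleftrightarrow> (\<forall>x\<in>U. \<exists>V\<in>um_base M. (\<lambda>v. x + v) ` V \<subseteq> U)"
proof -
  have refine: "\<exists>Z\<in>um_base M. Z \<subseteq> V \<inter> W" if VW: "V \<in> um_base M" "W \<in> um_base M" for V W
  proof -
    obtain m1 u1 e1 where V: "V = {x. m1 (inf \<bar>x\<bar> u1) < e1}" and
      1: "m1 \<in> M" "0 \<le> u1" "u1 \<noteq> 0" "0 < e1" using VW unfolding um_base_def by blast
    obtain m2 u2 e2 where W: "W = {x. m2 (inf \<bar>x\<bar> u2) < e2}" and
      2: "m2 \<in> M" "0 \<le> u2" "u2 \<noteq> 0" "0 < e2" using VW unfolding um_base_def by blast
    obtain m where m: "m \<in> M" "\<And>x. m1 x \<le> m x" "\<And>x. m2 x \<le> m x"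
    proof -
      have "\<exists>m\<in>M. \<forall>x. m1 x \<le> m x \<and> m2 x \<le> m x"
        using assms 1(1) 2(1) by (simp add: mnvl_def)
      then show ?thesis using that by blast
    qed
    let ?u = "sup u1 u2" and ?e = "min e1 e2"
    have u0: "0 \<le> ?u" using 1(2) by (rule le_supI1)
    have u: "0 \<le> ?u" "?u \<noteq> 0"
      using u0 1(2,3) sup.cobounded1[of u1 u2] by (blast, metis order.antisym)
    have mono: "m (inf \<bar>x\<bar> w) \<le> m (inf \<bar>x\<bar> ?u)" if "0 \<le> w" "w \<le> ?u" for x w
    proof -
      have "abs (inf (abs x) w) \<le> abs (inf (abs x) ?u)" using that u(1)
        by (simp add: inf.coboundedI2)
      then show ?thesis using assms m(1) by (simp add: mnvl_def lattice_seminorm_def)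
    qed
    have "{x. m (inf \<bar>x\<bar> ?u) < ?e} \<subseteq> V \<inter> W"
      unfolding V W using mono[OF 1(2)] mono[OF 2(2)] m(2,3) by (fastforce intro: le_less_trans)
    moreover have "{x. m (inf \<bar>x\<bar> ?u) < ?e} \<in> um_base M"
      by (rule um_baseI[of m M ?u ?e, OF m(1) u]) (simp add: 1 2)
    ultimately show ?thesis by blast
  qed
  have "istopology (\<lambda>U. \<forall>x\<in>U. \<exists>V\<in>um_base M. (\<lambda>v. x + v) ` V \<subseteq> U)"
    unfolding istopology_def
  proof (intro conjI allI impI)
    fix S T :: "'a set"
    assume S: "\<forall>x\<in>S. \<exists>V\<in>um_base M. (+) x ` V \<subseteq> S" and T: "\<forall>x\<in>T. \<exists>V\<in>um_base M. (+) x ` V \<subseteq> T"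
    show "\<forall>x\<in>S \<inter> T. \<exists>V\<in>um_base M. (+) x ` V \<subseteq> S \<inter> T"
    proof
      fix x assume "x \<in> S \<inter> T"
      then have x: "x \<in> S" "x \<in> T" by simp_all
      obtain V where V: "V \<in> um_base M" "(+) x ` V \<subseteq> S"
        using bspec[OF S x(1)] by (elim bexE)
      obtain W where W: "W \<in> um_base M" "(+) x ` W \<subseteq> T"
        using bspec[OF T x(2)] by (elim bexE)
      obtain Z where Z: "Z \<in> um_base M" "Z \<subseteq> V \<inter> W" using refine[OF V(1) W(1)] by (elim bexE)
      have "(+) x ` Z \<subseteq> S \<inter> T" using Z(2) V(2) W(2) by (auto simp: image_subset_iff)
      with Z(1) show "\<exists>V\<in>um_base M. (+) x ` V \<subseteq> S \<inter> T" by (rule bexI[rotated])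
    qed
  next
    fix K :: "'a set set"
    assume K: "\<forall>S\<in>K. \<forall>x\<in>S. \<exists>V\<in>um_base M. (+) x ` V \<subseteq> S"
    show "\<forall>x\<in>\<Union>K. \<exists>V\<in>um_base M. (+) x ` V \<subseteq> \<Union>K"
    proof
      fix x assume "x \<in> \<Union>K"
      then obtain S where S: "S \<in> K" "x \<in> S" by blast
      then obtain V where V: "V \<in> um_base M" "(+) x ` V \<subseteq> S"
        using bspec[OF bspec[OF K S(1)] S(2)] by (elim bexE)
      have "(+) x ` V \<subseteq> \<Union>K" using V(2) Union_upper[OF S(1)] by (rule subset_trans)
      with V(1) show "\<exists>V\<in>um_base M. (+) x ` V \<subseteq> \<Union>K" by (rule bexI[rotated])
    qed
  qed
  then show ?thesis unfolding um_topology_def by (simp add: topology_inverse')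
qed

lemma limitin_um_topology:
  fixes M :: "('a::vector_lattice \<Rightarrow> real) set"
  assumes M: "mnvl M" and nontrivial: "\<exists>x::'a. x \<noteq> 0"
  shows "limitin (um_topology M) f l F \<longleftrightarrow>
    (\<forall>u\<ge>0. \<forall>m\<in>M. ((\<lambda>i. m (inf \<bar>f i - l\<bar> u)) \<longlongrightarrow> 0) F)" (is "?L \<longleftrightarrow> ?R")
proof
  have sn: "lattice_seminorm m" if "m \<in> M" for m using M that by (simp add: mnvl_def)
  have zero: "m 0 = 0" if "m \<in> M" for m
  proof -
    have "m (0 *\<^sub>R 0) = \<bar>0\<bar> * m 0" using sn[OF that] unfolding lattice_seminorm_def by blast
    then show ?thesis by simp
  qed
  show ?R if L: ?L
  proof (intro allI impI ballI)
    fix u :: 'a and m assume u: "0 \<le> u" and m: "m \<in> M"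
    show "((\<lambda>i. m (inf \<bar>f i - l\<bar> u)) \<longlongrightarrow> 0) F"
    proof (cases "u = 0")
      case True
      then show ?thesis using zero[OF m] by (simp add: inf_absorb2)
    next
      case False
      have "eventually (\<lambda>i. m (inf \<bar>f i - l\<bar> u) < e) F" if e: "0 < e" for e
      proof -
        let ?B = "{y. m (inf \<bar>y - l\<bar> u) < e}"
        have "openin (um_topology M) ?B" unfolding openin_um_topology[OF M]
        proof
          fix x assume x: "x \<in> ?B"
          let ?d = "e - m (inf \<bar>x - l\<bar> u)"
          have "{v. m (inf \<bar>v\<bar> u) < ?d} \<in> um_base M"
            using um_baseI[of m M u ?d, OF m u False] x by simp
          moreover have "(+) x ` {v. m (inf \<bar>v\<bar> u) < ?d} \<subseteq> ?B"
          proof clarify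
            fix v assume v: "m (inf \<bar>v\<bar> u) < ?d"
            have "m (inf \<bar>(x - l) + v\<bar> u) \<le> m (inf \<bar>x - l\<bar> u) + m (inf \<bar>v\<bar> u)"
              by (rule um_seminorm_triangle[OF sn[OF m] u])
            then show "m (inf \<bar>x + v - l\<bar> u) < e" using v by (simp add: algebra_simps)
          qed
          ultimately show "\<exists>V\<in>um_base M. (+) x ` V \<subseteq> ?B" by blast
        qed
        moreover have "l \<in> ?B" using e zero[OF m] u by (simp add: inf_absorb1)
        ultimately show ?thesis using L unfolding limitin_def by auto
      qed
      then show ?thesis using lattice_seminorm_nonneg[OF sn[OF m]]
        by (simp add: tendsto_iff)
    qed
  qed
  show ?L if R: ?R
    unfolding limitin_def
  proof (intro conjI allI impI)
    obtain z :: 'a where "z \<noteq> 0" using nontrivial by blast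
    then have z: "\<bar>z\<bar> \<noteq> 0" "0 \<le> \<bar>z\<bar>" by auto
    obtain m where m: "m \<in> M" using M by (auto simp: mnvl_def)
    have "{x. m (inf \<bar>x\<bar> \<bar>z\<bar>) < 1} \<in> um_base M"
      using um_baseI[OF m z(2,1), of 1] by simp
    then have "openin (um_topology M) UNIV" unfolding openin_um_topology[OF M] by blast
    then show "l \<in> topspace (um_topology M)" using openin_subset by blast
  next
    fix U assume "openin (um_topology M) U \<and> l \<in> U"
    then obtain V where "V \<in> um_base M" and V: "(+) l ` V \<subseteq> U"
      using openin_um_topology[OF M] by blast
    then obtain m u e where Ve: "V = {x. m (inf \<bar>x\<bar> u) < e}" "m \<in> M" "0 \<le> u" "0 < e"
      unfolding um_base_def by blast
    then have "eventually (\<lambda>i. m (inf \<bar>f i - l\<bar> u) < e) F"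
      using R by (auto dest: order_tendstoD(2))
    then show "eventually (\<lambda>i. f i \<in> U) F"
    proof eventually_elim
      case (elim i)
      then have "f i - l \<in> V" using Ve by simp
      then have "l + (f i - l) \<in> U" using V by blast
      then show ?case by simp
    qed
  qed
qed

end

theory Submission
  imports Defs
begin

text \<open>Metrizability and completeness of the m-topology make every sequence of positive vectors
  dominated, up to scaling, by one vector. Dominating a countable topological orthogonal system
  gives a quasi-interior point; so does dominating the vectors \<open>u\<close> that occur in a countable
  um-base at zero. Conversely, a quasi-interior point \<open>e\<close> controls all truncations
  \<open>\<bar>x\<bar> \<sqinter> u\<close>, so the pseudometrics \<open>m (\<bar>x - y\<bar> \<sqinter> e)\<close> with \<open>m\<close> in a countable cofinal family
  already generate the um-topology.\<close>

section \<open>Lattice seminorms\<close>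

lemma lattice_seminorm_triangle: "lattice_seminorm m \<Longrightarrow> m (x + y) \<le> m x + m y"
  by (simp add: lattice_seminorm_def)

lemma lattice_seminorm_scale: "lattice_seminorm m \<Longrightarrow> m (c *\<^sub>R x) = \<bar>c\<bar> * m x"
  by (simp add: lattice_seminorm_def)

lemma lattice_seminorm_mono: "lattice_seminorm m \<Longrightarrow> \<bar>x\<bar> \<le> \<bar>y\<bar> \<Longrightarrow> m x \<le> m y"
  by (simp add: lattice_seminorm_def)

lemma lattice_seminorm_mono_pos:
  "lattice_seminorm m \<Longrightarrow> 0 \<le> x \<Longrightarrow> x \<le> y \<Longrightarrow> m x \<le> m y"
  by (metis abs_of_nonneg lattice_seminorm_mono order_trans)

lemma lattice_seminorm_zero: "lattice_seminorm m \<Longrightarrow> m 0 = 0"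
  using lattice_seminorm_scale[of m 0 0] by simp

lemma lattice_seminorm_minus: "lattice_seminorm m \<Longrightarrow> m (- x) = m x"
  using lattice_seminorm_scale[of m "-1" x] by simp

lemma lattice_seminorm_abs: "lattice_seminorm m \<Longrightarrow> m \<bar>x\<bar> = m x"
  by (intro antisym lattice_seminorm_mono) simp_all

lemma lattice_seminorm_sum_le:
  "lattice_seminorm m \<Longrightarrow> m (sum f A) \<le> (\<Sum>i\<in>A. m (f i))"
proof (induction A rule: infinite_finite_induct)
  case (insert a A)
  then show ?case using lattice_seminorm_triangle[of m "f a" "sum f A"] by simp
qed (simp_all add: lattice_seminorm_zero)

text \<open>By homogeneity: for every \<open>t > p x\<close>, the vector
  \<open>(\<epsilon> / t) *\<^sub>R x\<close> lies in the \<open>p\<close>-ball, so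
  \<open>\<epsilon> * m x \<le> t\<close>. Letting \<open>t\<close> decrease to \<open>p x\<close>
  avoids a separate case \<open>p x = 0\<close>.\<close>

lemma seminorm_le_of_ball_subset:
  assumes m: "lattice_seminorm m" and p: "lattice_seminorm p" and "0 < \<epsilon>"
    and ball: "\<And>x. p x < \<epsilon> \<Longrightarrow> m x < 1"
  shows "m x \<le> (1 / \<epsilon>) * p x"
proof -
  have "\<epsilon> * m x \<le> t" if t: "p x < t" for t
  proof -
    have "0 < t" using t lattice_seminorm_nonneg[OF p, of x] by simp
    then have "p ((\<epsilon> / t) *\<^sub>R x) < \<epsilon>"
      using t \<open>0 < \<epsilon>\<close> by (simp add: lattice_seminorm_scale[OF p] field_simps)
    from ball[OF this] show ?thesis
      using \<open>0 < t\<close> \<open>0 < \<epsilon>\<close> by (simp add: lattice_seminorm_scale[OF m] field_simps)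
  qed
  then have "\<epsilon> * m x \<le> p x" by (rule dense_ge)
  then show ?thesis using \<open>0 < \<epsilon>\<close> by (simp add: field_simps)
qed

section \<open>Inequalities for truncations in vector lattices\<close>

text \<open>Divided by \<open>c\<close>, the left side lies below
  \<open>(1 / c) *\<^sub>R x\<close>, which is at most \<open>x\<close> because
  \<open>c \<ge> 1\<close>, and below \<open>e\<close>.\<close>

lemma inf_scaleR_le:
  fixes x e :: "'a::vector_lattice"
  assumes "0 \<le> x" "1 \<le> c"
  shows "inf x (c *\<^sub>R e) \<le> c *\<^sub>R inf x e"
proof -
  have c: "0 < c" using assms by simp
  have x: "(1 / c) *\<^sub>R x \<le> x"
    using assms scaleR_right_mono[of "1 / c" 1 x] by simp
  have "(1 / c) *\<^sub>R inf x (c *\<^sub>R e) \<le> (1 / c) *\<^sub>R x"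
    and e: "(1 / c) *\<^sub>R inf x (c *\<^sub>R e) \<le> (1 / c) *\<^sub>R (c *\<^sub>R e)"
    using c by (intro scaleR_left_mono; simp)+
  then have "(1 / c) *\<^sub>R inf x (c *\<^sub>R e) \<le> inf x e"
    using x c by simp
  then have "c *\<^sub>R ((1 / c) *\<^sub>R inf x (c *\<^sub>R e)) \<le> c *\<^sub>R inf x e"
    using c by (intro scaleR_left_mono) auto
  then show ?thesis using c by simp
qed

text \<open>Disjointness of the negative and the positive part of \<open>z\<close>. As the negative
  part is \<open>pprt z - z\<close>, the summand \<open>pprt z\<close> can be pulled out of the
  meet, which leaves \<open>inf (- z) 0 = - pprt z\<close>.\<close>

lemma inf_pprt_uminus: "inf (pprt (- z)) (pprt z) = (0::'a::vector_lattice)"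
proof -
  have "pprt (- z) = pprt z + - z" using prts[of z] by (simp add: pprt_neg algebra_simps)
  then have "inf (pprt (- z)) (pprt z) = pprt z + inf (- z) 0"
    using add_inf_distrib_left[of "pprt z" "- z" 0] by simp
  also have "inf (- z) 0 = - pprt z" unfolding pprt_def neg_sup_eq_inf by simp
  finally show ?thesis by simp
qed

text \<open>Heuristically: wherever \<open>y > n u\<close>, we have \<open>u < y / n\<close>.\<close>

lemma inf_pprt_diff_le:
  fixes y u :: "'a::vector_lattice"
  assumes "0 \<le> y" "0 \<le> u" and n: "1 \<le> (n::real)"
  shows "n *\<^sub>R inf (pprt (y - n *\<^sub>R u)) u \<le> y"
proof -
  let ?z = "y - n *\<^sub>R u" and ?w = "inf (pprt (y - n *\<^sub>R u)) u"
  have w: "n *\<^sub>R ?w \<le> n *\<^sub>R u" "n *\<^sub>R ?w \<le> n *\<^sub>R pprt ?z"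
    using n by (intro scaleR_left_mono; simp)+
  \<comment> \<open>The excess of \<open>n *\<^sub>R ?w\<close> over \<open>y\<close> vanishes
    because it lies below the negative part of \<open>?z\<close> and below \<open>n\<close> times
    its positive part.\<close>
  have "pprt (n *\<^sub>R ?w - y) \<le> pprt (- ?z)" using w by (intro pprt_mono) simp
  moreover have "n *\<^sub>R ?w - y \<le> n *\<^sub>R pprt ?z"
    using w(2) \<open>0 \<le> y\<close> by (metis diff_add_cancel add_increasing2 diff_le_eq)
  then have "pprt (n *\<^sub>R ?w - y) \<le> n *\<^sub>R pprt ?z"
    using n unfolding pprt_def[of "n *\<^sub>R ?w - y"] by (simp add: scaleR_nonneg_nonneg)
  ultimately have "pprt (n *\<^sub>R ?w - y) \<le> inf (pprt (- ?z)) (n *\<^sub>R pprt ?z)" by simp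
  also have "\<dots> \<le> n *\<^sub>R inf (pprt (- ?z)) (pprt ?z)" using n by (intro inf_scaleR_le) auto
  also have "inf (pprt (- ?z)) (pprt ?z) = 0"
    by (rule inf_pprt_uminus)
  finally have "pprt (n *\<^sub>R ?w - y) \<le> 0" by simp
  then show ?thesis unfolding pprt_def by simp
qed

text \<open>Since \<open>u \<le> \<bar>v\<bar> + \<bar>u - v\<bar>\<close>, truncation at
  \<open>u\<close> splits into truncation at \<open>\<bar>v\<bar>\<close>, controlled by
  \<open>e\<close>, and an error of size \<open>\<bar>u - v\<bar>\<close>. It is meant for
  \<open>v\<close> in the ideal of \<open>e\<close> approximating \<open>u\<close>.\<close>

lemma inf_le_scaled_inf_add:
  fixes x u v e :: "'a::vector_lattice"
  assumes "0 \<le> x" "0 \<le> e" "1 \<le> c" "\<bar>v\<bar> \<le> c *\<^sub>R e"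
  shows "inf x u \<le> c *\<^sub>R inf x e + \<bar>u - v\<bar>"
proof -
  have "u \<le> \<bar>v\<bar> + \<bar>u - v\<bar>"
    by (metis abs_ge_self abs_triangle_ineq add_diff_cancel_left' diff_add_cancel add.commute order_trans)
  then have "inf x u \<le> inf (\<bar>v\<bar> + \<bar>u - v\<bar>) x" by (meson inf.bounded_iff inf_le1 inf_le2 order_trans)
  also have "\<dots> \<le> inf \<bar>v\<bar> x + inf \<bar>u - v\<bar> x" using assms by (intro inf_add_le) auto
  also have "\<dots> \<le> inf x (c *\<^sub>R e) + \<bar>u - v\<bar>"
    using assms by (intro add_mono) (auto intro: le_infI2 le_infI1)
  also have "\<dots> \<le> c *\<^sub>R inf x e + \<bar>u - v\<bar>"
    using inf_scaleR_le[OF assms(1,3)] by simp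
  finally show ?thesis .
qed

section \<open>Order ideals\<close>

lemma order_ideal_scaleR: "order_ideal I \<Longrightarrow> x \<in> I \<Longrightarrow> c *\<^sub>R x \<in> I"
  by (simp add: order_ideal_def subspace_scale)

lemma order_ideal_solid: "order_ideal I \<Longrightarrow> x \<in> I \<Longrightarrow> \<bar>y\<bar> \<le> \<bar>x\<bar> \<Longrightarrow> y \<in> I"
  unfolding order_ideal_def by blast

text \<open>The vectors on the right form an order ideal containing \<open>e\<close>, and any ideal
  containing \<open>e\<close> contains them by solidity. As \<open>e\<close> is positive, multiples
  can be enlarged to have \<open>c \<ge> 1\<close>, the form that \<open>inf_scaleR_le\<close>
  requires.\<close>

lemma order_ideal_hull_singleton_iff:
  fixes e :: "'a::vector_lattice"
  assumes "0 \<le> e"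
  shows "x \<in> order_ideal hull {e} \<longleftrightarrow> (\<exists>c\<ge>1. \<bar>x\<bar> \<le> c *\<^sub>R e)" (is "_ \<longleftrightarrow> ?R x")
proof
  have "order_ideal {x. ?R x}"
    unfolding order_ideal_def subspace_def
  proof (intro conjI allI ballI impI; clarsimp)
    show "\<exists>c\<ge>1. 0 \<le> c *\<^sub>R e" using assms by (intro exI[of _ 1]) simp
  next
    fix x y c d assume *: "1 \<le> c" "\<bar>x\<bar> \<le> c *\<^sub>R e" "1 \<le> d" "\<bar>y\<bar> \<le> d *\<^sub>R e"
    have "\<bar>x + y\<bar> \<le> (c + d) *\<^sub>R e"
      unfolding scaleR_left_distrib
      by (rule order_trans[OF abs_triangle_ineq add_mono]) (use * in simp_all)
    then show "\<exists>c\<ge>1. \<bar>x + y\<bar> \<le> c *\<^sub>R e" using * by (intro exI[of _ "c + d"]) simp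
  next
    fix a x c assume *: "1 \<le> c" "\<bar>x\<bar> \<le> c *\<^sub>R e"
    have x: "x \<le> c *\<^sub>R e" "- x \<le> c *\<^sub>R e"
      using * by (metis abs_ge_self order_trans, metis abs_ge_minus_self order_trans)
    have y: "\<bar>a\<bar> *\<^sub>R z \<le> \<bar>a\<bar> *\<^sub>R (c *\<^sub>R e)" if "z \<le> c *\<^sub>R e" for z
      using that by (rule scaleR_left_mono) simp
    have "\<bar>a *\<^sub>R x\<bar> \<le> \<bar>a\<bar> *\<^sub>R (c *\<^sub>R e)"
      using y[OF x(1)] y[OF x(2)] by (intro abs_leI) (cases "0 \<le> a"; simp)+
    \<comment> \<open>The extra 1 keeps the coefficient at least 1 even when \<open>a\<close> is
      small or zero.\<close>
    also have "\<dots> \<le> (\<bar>a\<bar> * c + 1) *\<^sub>R e"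
      using assms by (simp add: scaleR_left_distrib)
    finally show "\<exists>c\<ge>1. \<bar>a *\<^sub>R x\<bar> \<le> c *\<^sub>R e" using * by (intro exI[of _ "\<bar>a\<bar> * c + 1"]) simp
  next
    fix x y c assume "\<bar>y\<bar> \<le> \<bar>x\<bar>" "1 \<le> c" "\<bar>x\<bar> \<le> c *\<^sub>R e"
    then show "\<exists>c\<ge>1. \<bar>y\<bar> \<le> c *\<^sub>R e" by (meson order_trans)
  qed
  moreover have "{e} \<subseteq> {x. ?R x}" using assms by (auto intro: exI[of _ 1])
  ultimately have "order_ideal hull {e} \<subseteq> {x. ?R x}" by (intro hull_minimal)
  then show "x \<in> order_ideal hull {e} \<Longrightarrow> ?R x" by blast
next
  assume "?R x"
  then obtain c where c: "1 \<le> c" "\<bar>x\<bar> \<le> c *\<^sub>R e" by blast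
  have "c *\<^sub>R e \<in> order_ideal hull {e}"
    by (intro order_ideal_scaleR order_ideal_hull) (simp add: hull_inc)
  moreover have "\<bar>c *\<^sub>R e\<bar> = c *\<^sub>R e" using c assms by (simp add: scaleR_nonneg_nonneg)
  ultimately show "x \<in> order_ideal hull {e}"
    using order_ideal_solid[OF order_ideal_hull] c by metis
qed

section \<open>Directed families of seminorms and the m-topology\<close>

lemma mnvl_seminorm: "mnvl M \<Longrightarrow> m \<in> M \<Longrightarrow> lattice_seminorm m"
  by (simp add: mnvl_def)

lemma mnvl_eq_0: "mnvl M \<Longrightarrow> (\<And>m. m \<in> M \<Longrightarrow> m x = 0) \<Longrightarrow> x = 0"
  unfolding mnvl_def by blast

lemma mnvl_directed2:
  assumes "mnvl M" "m1 \<in> M" "m2 \<in> M"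
  obtains m where "m \<in> M" "\<And>x. m1 x \<le> m x" "\<And>x. m2 x \<le> m x"
proof -
  have "\<exists>m\<in>M. \<forall>x. m1 x \<le> m x \<and> m2 x \<le> m x" using assms by (simp add: mnvl_def)
  then show ?thesis using that by blast
qed

text \<open>Directedness iterated, with nonemptiness of \<open>M\<close> settling
  \<open>n = 0\<close>. It later provides one seminorm that controls an initial segment of the
  series defining the um-metric.\<close>

lemma mnvl_directed_lessThan:
  assumes "mnvl M" "\<And>k. p k \<in> M"
  shows "\<exists>m\<in>M. \<forall>k<(n::nat). \<forall>x. p k x \<le> m x"
proof (induction n)
  case 0
  then show ?case using assms(1) by (auto simp: mnvl_def)
next
  case (Suc n)
  then obtain m1 where m1: "m1 \<in> M" "\<And>k x. k < n \<Longrightarrow> p k x \<le> m1 x" by blast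
  obtain m where "m \<in> M" "\<And>x. m1 x \<le> m x" "\<And>x. p n x \<le> m x"
    using mnvl_directed2[OF assms(1) m1(1) assms(2)] by blast
  then show ?case using m1 by (metis less_Suc_eq order_trans)
qed

lemma openin_m_ball:
  assumes "m \<in> M" "0 < \<epsilon>"
  shows "openin (m_topology M) {y. m (y - x) < \<epsilon>}"
  unfolding m_topology_def using assms by (intro topology_generated_by_Basis) blast

text \<open>The balls are given only as a subbasis. Directedness lets one ball fit inside the
  intersection of two, and the triangle inequality recentres a ball at any of its points, so balls
  centred at a point form a neighbourhood base there.\<close>

lemma openin_m_topology:
  fixes M :: "('a::vector_lattice \<Rightarrow> real) set"
  assumes M: "mnvl M"
  shows "openin (m_topology M) U \<longleftrightarrow>
    (\<forall>x\<in>U. \<exists>m\<in>M. \<exists>\<epsilon>>0. {y. m (y - x) < \<epsilon>} \<subseteq> U)" (is "_ \<longleftrightarrow> ?R U")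
proof
  let ?S = "{{y. m (y - x) < \<epsilon>} | m x \<epsilon>. m \<in> M \<and> 0 < \<epsilon>}"
  assume "openin (m_topology M) U"
  then have "generate_topology_on ?S U"
    unfolding m_topology_def by (rule openin_topology_generated_by)
  then show "?R U"
  proof (induction)
    case (Int a b)
    show ?case
    proof
      fix x assume "x \<in> a \<inter> b"
      then obtain m1 e1 m2 e2 where
        1: "m1 \<in> M" "0 < e1" "{y. m1 (y - x) < e1} \<subseteq> a" and
        2: "m2 \<in> M" "0 < e2" "{y. m2 (y - x) < e2} \<subseteq> b"
        using Int.IH by (meson IntD1 IntD2)
      obtain m where "m \<in> M" "\<And>x. m1 x \<le> m x" "\<And>x. m2 x \<le> m x"
        using mnvl_directed2[OF M 1(1) 2(1)] by blast
      then have "{y. m (y - x) < min e1 e2} \<subseteq> a \<inter> b" 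
        using 1(3) 2(3) by (fastforce intro: le_less_trans)
      then show "\<exists>m\<in>M. \<exists>\<epsilon>>0. {y. m (y - x) < \<epsilon>} \<subseteq> a \<inter> b"
        using \<open>m \<in> M\<close> 1(2) 2(2) by (metis min_less_iff_conj)
    qed
  next
    case (UN K)
    show ?case
    proof
      fix x assume "x \<in> \<Union>K"
      then obtain k where k: "k \<in> K" "x \<in> k" by blast
      then obtain m e where "m \<in> M" "e > 0" "{y. m (y - x) < e} \<subseteq> k"
        using UN.IH by blast
      with k show "\<exists>m\<in>M. \<exists>\<epsilon>>0. {y. m (y - x) < \<epsilon>} \<subseteq> \<Union>K" by blast
    qed
  next
    case (Basis s)
    then obtain m z e where s: "s = {y. m (y - z) < e}" and m: "m \<in> M" and "0 < e" by blast
    show ?case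
    proof
      fix x assume "x \<in> s"
      then have "0 < e - m (x - z)" by (simp add: s)
      moreover have "{y. m (y - x) < e - m (x - z)} \<subseteq> s"
      proof clarify
        fix y assume "m (y - x) < e - m (x - z)"
        then show "y \<in> s"
          using lattice_seminorm_triangle[OF mnvl_seminorm[OF M m], of "y - x" "x - z"]
          by (simp add: s)
      qed
      ultimately show "\<exists>m\<in>M. \<exists>\<epsilon>>0. {y. m (y - x) < \<epsilon>} \<subseteq> s" using m by blast
    qed
  qed simp
next
  assume R: "?R U"
  have "\<exists>T. openin (m_topology M) T \<and> x \<in> T \<and> T \<subseteq> U" if xU: "x \<in> U" for x
  proof -
    obtain m e where m: "m \<in> M" "0 < e" "{y. m (y - x) < e} \<subseteq> U"
      using bspec[OF R xU] by (elim bexE exE conjE)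
    have "openin (m_topology M) {y. m (y - x) < e}"
      using m(1,2) by (rule openin_m_ball)
    moreover have "x \<in> {y. m (y - x) < e}"
      using m(2) lattice_seminorm_zero[OF mnvl_seminorm[OF M m(1)]] by simp
    ultimately show ?thesis using m(3) by blast
  qed
  then show "openin (m_topology M) U" unfolding openin_subopen[of _ U] by blast
qed

lemma topspace_m_topology: "mnvl M \<Longrightarrow> topspace (m_topology M) = UNIV"
proof -
  assume M: "mnvl M"
  then have "M \<noteq> {}" by (simp add: mnvl_def)
  then have "openin (m_topology M) UNIV"
    unfolding openin_m_topology[OF M] using zero_less_one by blast
  then show ?thesis using openin_subset by blast
qed

lemma openin_m_topologyE:
  assumes "mnvl M" "openin (m_topology M) U" "x \<in> U"
  obtains m \<epsilon> where "m \<in> M" "0 < \<epsilon>" "{y. m (y - x) < \<epsilon>} \<subseteq> U"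
  using bspec[OF assms(2)[unfolded openin_m_topology[OF assms(1)]] assms(3)]
  by (elim bexE exE conjE)

lemma dense_m_topology_iff:
  fixes M :: "('a::vector_lattice \<Rightarrow> real) set"
  assumes M: "mnvl M"
  shows "m_topology M closure_of S = UNIV \<longleftrightarrow> (\<forall>x. \<forall>m\<in>M. \<forall>\<epsilon>>0. \<exists>y\<in>S. m (y - x) < \<epsilon>)"
    (is "?L \<longleftrightarrow> ?R")
proof
  assume ?L
  show ?R
  proof (intro allI ballI impI)
    fix x m and e :: real assume m: "m \<in> M" "0 < e"
    have "x \<in> {y. m (y - x) < e}"
      using m lattice_seminorm_zero[OF mnvl_seminorm[OF M m(1)]] by simp
    moreover have "\<forall>T. x \<in> T \<and> openin (m_topology M) T \<longrightarrow> (\<exists>y. y \<in> S \<and> y \<in> T)"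
      using \<open>?L\<close> in_closure_of[of x "m_topology M" S] by simp
    ultimately have "\<exists>y. y \<in> S \<and> y \<in> {y. m (y - x) < e}"
      using openin_m_ball[OF m, of x] by (elim allE[of _ "{y. m (y - x) < e}"] impE conjI)
    then show "\<exists>y\<in>S. m (y - x) < e" by auto
  qed
next
  assume ?R
  have "x \<in> m_topology M closure_of S" for x
    unfolding in_closure_of topspace_m_topology[OF M]
  proof (intro conjI allI impI UNIV_I)
    fix T assume T: "x \<in> T \<and> openin (m_topology M) T"
    obtain m e where m: "m \<in> M" "0 < e" "{y. m (y - x) < e} \<subseteq> T"
      by (rule openin_m_topologyE[OF M conjunct2[OF T] conjunct1[OF T]])
    obtain y where "y \<in> S" "m (y - x) < e" using \<open>?R\<close> m(1,2) by blast
    then show "\<exists>y. y \<in> S \<and> y \<in> T" using m(3) by blast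
  qed
  then show ?L by blast
qed

section \<open>Countable bases at zero and dominating vectors\<close>

lemma first_countable_nbhd_sequence:
  assumes "first_countable X" "x \<in> topspace X"
  obtains V :: "nat \<Rightarrow> 'a set" where "\<And>n. openin X (V n)" "\<And>n. x \<in> V n"
    "\<And>U. openin X U \<Longrightarrow> x \<in> U \<Longrightarrow> \<exists>n. V n \<subseteq> U"
proof -
  obtain B where B: "countable B" "\<And>V. V \<in> B \<Longrightarrow> openin X V"
    "\<And>U. openin X U \<Longrightarrow> x \<in> U \<Longrightarrow> \<exists>V\<in>B. x \<in> V \<and> V \<subseteq> U"
    using assms unfolding first_countable_def by metis
  \<comment> \<open>Sets in \<open>B\<close> may miss \<open>x\<close> and are dropped. Applying the
    base property to the whole space shows that \<open>C\<close> is nonempty, as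
    \<open>from_nat_into\<close> needs.\<close>
  define C where "C = {V \<in> B. x \<in> V}"
  have C: "countable C" "C \<noteq> {}"
    using B(1) B(3)[OF openin_topspace assms(2)] by (auto simp: C_def)
  show ?thesis
  proof
    fix n
    show "openin X (from_nat_into C n)" "x \<in> from_nat_into C n"
      using from_nat_into[OF C(2), of n] B(2) by (auto simp: C_def)
  next
    fix U assume "openin X U" "x \<in> U"
    then obtain V where "V \<in> C" "V \<subseteq> U" using B(3) by (auto simp: C_def)
    then show "\<exists>n. from_nat_into C n \<subseteq> U" using from_nat_into_surj[OF C(1)] by metis
  qed
qed

text \<open>Every member of a countable base at zero contains a ball of some \<open>p n\<close>, and
  the unit ball of each \<open>m\<close> contains such a member. Homogeneity turns this inclusion of
  balls into an inequality, so cofinality holds up to a constant.\<close>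

lemma cofinal_seminorm_sequence:
  fixes M :: "('a::vector_lattice \<Rightarrow> real) set"
  assumes M: "mnvl M" and "metrizable_space (m_topology M)"
  obtains p :: "nat \<Rightarrow> 'a \<Rightarrow> real" where "\<And>k. p k \<in> M"
    "\<And>m. m \<in> M \<Longrightarrow> \<exists>k. \<exists>C>0. \<forall>x. m x \<le> C * p k x"
proof -
  obtain V :: "nat \<Rightarrow> 'a set" where V: "\<And>n. openin (m_topology M) (V n)" "\<And>n. 0 \<in> V n"
    "\<And>U. openin (m_topology M) U \<Longrightarrow> 0 \<in> U \<Longrightarrow> \<exists>n. V n \<subseteq> U"
    using first_countable_nbhd_sequence[of "m_topology M" 0]
      metrizable_imp_first_countable[OF assms(2)] topspace_m_topology[OF M] by auto
  have "\<exists>m e. m \<in> M \<and> 0 < e \<and> {y. m y < e} \<subseteq> V n" for n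
    using V(1,2)[of n] unfolding openin_m_topology[OF M] by force
  then obtain p e where p: "\<And>n. p n \<in> M" "\<And>n. 0 < (e n :: real)" "\<And>n. {y. p n y < e n} \<subseteq> V n"
    by metis
  show ?thesis
  proof
    fix m assume m: "m \<in> M"
    have "openin (m_topology M) {y. m (y - 0) < 1}" using m by (intro openin_m_ball) auto
    moreover have "0 \<in> {y. m (y - 0) < 1}"
      using lattice_seminorm_zero[OF mnvl_seminorm[OF M m]] by simp
    ultimately obtain n where n: "V n \<subseteq> {y. m (y - 0) < 1}" using V(3) by blast
    have "m x \<le> (1 / e n) * p n x" for x
      using mnvl_seminorm[OF M m] mnvl_seminorm[OF M p(1)] p(2)
    proof (rule seminorm_le_of_ball_subset)
      show "p n x < e n \<Longrightarrow> m x < 1" for x using p(3) n by fastforce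
    qed
    then show "\<exists>k. \<exists>C>0. \<forall>x. m x \<le> C * p k x" using p(2) by (intro exI[of _ n] exI[of _ "1 / e n"]) simp
  qed (rule p(1))
qed

text \<open>The element \<open>l\<close> is the sum of a series \<open>\<Sum>i. c i *\<^sub>R v i\<close> with rapidly decreasing \<open>c\<close>.\<close>

lemma dominating_element:
  fixes M :: "('a::vector_lattice \<Rightarrow> real) set" and v :: "nat \<Rightarrow> 'a"
  assumes M: "mnvl M" and met: "metrizable_space (m_topology M)"
    and complete: "complete_linear_topology (m_topology M)"
    and v: "\<And>n. 0 \<le> v n"
  shows "\<exists>l\<ge>0. \<forall>n. \<exists>c\<ge>1. v n \<le> c *\<^sub>R l"
proof -
  obtain p :: "nat \<Rightarrow> 'a \<Rightarrow> real" where p: "\<And>k. p k \<in> M"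
    and cofinal: "\<And>m. m \<in> M \<Longrightarrow> \<exists>k. \<exists>C>0. \<forall>x. m x \<le> C * p k x"
    using cofinal_seminorm_sequence[OF M met] by blast
  note sn = mnvl_seminorm[OF M]
  \<comment> \<open>The sum makes \<open>c n *\<^sub>R v n\<close> of size at most
    \<open>(1/2) ^ n\<close> for all \<open>p k\<close> with \<open>k \<le> n\<close> at once. The
    summand 1 keeps the denominator positive and yields \<open>c n \<le> 1\<close>, hence
    \<open>1 / c n \<ge> 1\<close> at the end.\<close>
  define c where "c n = (1/2) ^ n / (1 + (\<Sum>k\<le>n. p k (v n)))" for n
  define s where "s n = (\<Sum>i<n. c i *\<^sub>R v i)" for n
  have pv: "0 \<le> p k (v n)" for k n using lattice_seminorm_nonneg[OF sn[OF p]] .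
  have D: "0 < 1 + (\<Sum>k\<le>n. p k (v n))" for n by (simp add: add_pos_nonneg pv sum_nonneg)
  have c0: "0 < c n" for n using D by (simp add: c_def)
  have c1: "c n \<le> 1" for n
  proof -
    have "(1/2) ^ n \<le> (1::real)" by (simp add: power_le_one)
    also have "\<dots> \<le> 1 + (\<Sum>k\<le>n. p k (v n))" by (simp add: pv sum_nonneg)
    finally show ?thesis using D by (simp add: c_def divide_le_eq)
  qed
  have small: "p k (c n *\<^sub>R v n) \<le> (1/2) ^ n" if "k \<le> n" for k n
  proof -
    have "p k (v n) \<le> (\<Sum>k\<le>n. p k (v n))" using that by (intro member_le_sum) (auto simp: pv)
    then have "(1/2)^n * p k (v n) \<le> (1/2) ^ n * (1 + (\<Sum>k\<le>n. p k (v n)))"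
      by (intro mult_left_mono) auto
    then show ?thesis unfolding lattice_seminorm_scale[OF sn[OF p]]
      using D[of n] c0[of n] by (simp add: c_def divide_le_eq)
  qed
  have term_nonneg: "0 \<le> c i *\<^sub>R v i" for i using c0 v by (simp add: less_imp_le scaleR_nonneg_nonneg)
  have tail: "p k (s b - s a) \<le> 2 * (1/2) ^ a" if "k \<le> a" "a \<le> b" for k a b
  proof -
    have "s b - s a = (\<Sum>i=a..<b. c i *\<^sub>R v i)"
      unfolding s_def using sum_diff_nat_ivl[of 0 a b "\<lambda>i. c i *\<^sub>R v i"] that by (simp add: lessThan_atLeast0)
    then have "p k (s b - s a) \<le> (\<Sum>i=a..<b. p k (c i *\<^sub>R v i))"
      using lattice_seminorm_sum_le[OF sn[OF p]] by simp
    also have "\<dots> \<le> (\<Sum>i=a..<b. (1/2) ^ i)" using that by (intro sum_mono small) auto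
    also have "\<dots> \<le> 2 * (1/2) ^ a"
      using sum_gp[of "1/2::real" a "b - 1"] that by (cases b) (auto simp: atLeastLessThanSuc_atLeastAtMost)
    finally show ?thesis .
  qed
  have cauchy: "\<exists>N. \<forall>i\<ge>N. \<forall>j\<ge>N. m (s i - s j) < \<epsilon>" if m: "m \<in> M" and "0 < \<epsilon>" for m \<epsilon>
  proof -
    obtain k C where C: "0 < C" "\<And>x. m x \<le> C * p k x" using cofinal[OF m] by blast
    have "(\<lambda>n. C * (2 * (1/2) ^ n)) \<longlonglongrightarrow> C * (2 * 0)"
      by (intro tendsto_intros LIMSEQ_realpow_zero) auto
    then have "eventually (\<lambda>n. C * (2 * (1/2) ^ n) < \<epsilon>) sequentially"
      using \<open>0 < \<epsilon>\<close> by (auto dest: order_tendstoD(2))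
    then obtain N0 where N0: "\<And>n. N0 \<le> n \<Longrightarrow> C * (2 * (1/2) ^ n) < \<epsilon>"
      unfolding eventually_sequentially by blast
    \<comment> \<open>The tail estimate for \<open>p k\<close> is available only from index
      \<open>k\<close> on.\<close>
    let ?N = "max N0 k"
    have le: "m (s j - s i) < \<epsilon>" if "?N \<le> i" "i \<le> j" for i j
    proof -
      have "m (s j - s i) \<le> C * p k (s j - s i)" by (rule C)
      also have "\<dots> \<le> C * (2 * (1/2) ^ i)" using that C by (intro mult_left_mono tail) auto
      also have "\<dots> < \<epsilon>" using that by (intro N0) auto
      finally show ?thesis .
    qed
    have "m (s i - s j) < \<epsilon>" if "?N \<le> i" "?N \<le> j" for i j
      using le[of i j] le[of j i] that lattice_seminorm_minus[OF sn[OF m], of "s i - s j"]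
      by (cases "i \<le> j") auto
    then show ?thesis by blast
  qed
  have "\<exists>l. limitin (m_topology M) (\<lambda>x. x) l (filtermap s sequentially)"
  proof -
    have "\<forall>\<^sub>F (x, y) in filtermap s sequentially \<times>\<^sub>F filtermap s sequentially. x - y \<in> U"
      if U: "openin (m_topology M) U \<and> 0 \<in> U" for U
    proof -
      obtain m e where m: "m \<in> M" "0 < e" "{y. m y < e} \<subseteq> U"
        using U unfolding openin_m_topology[OF M] by force
      then show ?thesis
        using cauchy[OF m(1,2)]
        by (simp add: prod_filtermap1 prod_filtermap2 eventually_filtermap
            eventually_prod_sequentially case_prod_unfold subset_iff) meson
    qed
    then show ?thesis
      using complete unfolding complete_linear_topology_def
      by (simp add: filtermap_bot_iff)
  qed
  then obtain l where l: "limitin (m_topology M) (\<lambda>x. x) l (filtermap s sequentially)" ..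
  have le: "c n *\<^sub>R v n \<le> l" for n
  proof -
    let ?a = "c n *\<^sub>R v n"
    \<comment> \<open>For \<open>i > n\<close> the partial sum \<open>s i\<close> dominates
      \<open>?a\<close>, so this positive part lies below \<open>\<bar>s i - l\<bar>\<close>, on
      which every seminorm becomes arbitrarily small.\<close>
    have "pprt (?a - l) = 0"
    proof (rule mnvl_eq_0[OF M])
      fix m assume m: "m \<in> M"
      have "m (pprt (?a - l)) \<le> 0 + e" if "0 < e" for e
      proof -
        have "l \<in> {y. m (y - l) < e}" using that lattice_seminorm_zero[OF sn[OF m]] by simp
        then have "eventually (\<lambda>i. m (s i - l) < e) sequentially"
          using l openin_m_ball[OF m that, of l] unfolding limitin_def eventually_filtermap
          by fastforce
        then have "eventually (\<lambda>i. n < i \<and> m (s i - l) < e) sequentially"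
          using eventually_gt_at_top by (rule eventually_conj[rotated])
        then obtain i where i: "n < i" "m (s i - l) < e"
          by (metis (mono_tags, lifting) eventually_sequentially order_refl)
        have "?a \<le> s i" unfolding s_def
          using sum_mono2[of "{..<i}" "{n}" "\<lambda>i. c i *\<^sub>R v i"] i(1) term_nonneg by simp
        then have "pprt (?a - l) \<le> pprt (s i - l)" by (intro pprt_mono) simp
        also have "\<dots> \<le> \<bar>s i - l\<bar>" by (simp add: pprt_def abs_ge_self)
        finally have "m (pprt (?a - l)) \<le> m \<bar>s i - l\<bar>"
          by (intro lattice_seminorm_mono_pos sn m) simp_all
        then show ?thesis using i(2) lattice_seminorm_abs[OF sn[OF m]] by simp
      qed
      then have "m (pprt (?a - l)) \<le> 0" by (rule field_le_epsilon)
      then show "m (pprt (?a - l)) = 0"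
        using lattice_seminorm_nonneg[OF sn[OF m]] by (simp add: antisym)
    qed
    then show ?thesis using le_zero_iff_zero_pprt[of "?a - l"] by simp
  qed
  show ?thesis
  proof (intro exI[of _ l] conjI allI)
    show "0 \<le> l" using term_nonneg le by (rule order_trans)
  next
    fix n
    have "(1 / c n) *\<^sub>R (c n *\<^sub>R v n) \<le> (1 / c n) *\<^sub>R l"
      using c0[of n] le by (intro scaleR_left_mono) auto
    then have "v n \<le> (1 / c n) *\<^sub>R l" using c0[of n] by simp
    moreover have "1 \<le> 1 / c n" using c0[of n] c1[of n] by (simp add: le_divide_eq)
    ultimately show "\<exists>c\<ge>1. v n \<le> c *\<^sub>R l" by blast
  qed
qed

section \<open>Quasi-interior points and orthogonal systems\<close>

text \<open>If \<open>e\<close> were 0, its ideal would be trivial, and density would make every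
  seminorm vanish identically, against separation in a nontrivial space.\<close>

lemma quasi_interior_pointI:
  fixes M :: "('a::vector_lattice \<Rightarrow> real) set"
  assumes nontrivial: "\<exists>x::'a. x \<noteq> 0" and M: "mnvl M" and e: "0 \<le> e"
    and dense: "m_topology M closure_of (order_ideal hull {e}) = UNIV"
  shows "quasi_interior_point M e"
proof -
  have "e \<noteq> 0"
  proof
    assume e0: "e = 0"
    have "x = 0" for x :: 'a
    proof (rule mnvl_eq_0[OF M])
      fix m assume m: "m \<in> M"
      have "m x \<le> 0 + \<epsilon>" if \<epsilon>: "0 < \<epsilon>" for \<epsilon>
      proof -
        obtain y where "y \<in> order_ideal hull {e}" "m (y - x) < \<epsilon>"
          using dense m \<epsilon> unfolding dense_m_topology_iff[OF M] by blast
        moreover from this have "y = 0"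
          using order_ideal_hull_singleton_iff[OF e, of y] e0 by simp
        ultimately show ?thesis using lattice_seminorm_minus[OF mnvl_seminorm[OF M m], of x] by simp
      qed
      then have "m x \<le> 0" by (rule field_le_epsilon)
      then show "m x = 0"
        using lattice_seminorm_nonneg[OF mnvl_seminorm[OF M m]] by (simp add: antisym)
    qed
    then show False using nontrivial by blast
  qed
  then show ?thesis using e dense by (simp add: quasi_interior_point_def)
qed

lemma quasi_interior_point_of_topological_orthogonal_system:
  fixes M :: "('a::vector_lattice \<Rightarrow> real) set"
  assumes nontrivial: "\<exists>x::'a. x \<noteq> 0" and M: "mnvl M"
    and met: "metrizable_space (m_topology M)"
    and complete: "complete_linear_topology (m_topology M)"
    and Q: "countable Q" "topological_orthogonal_system M Q"
  shows "\<exists>e. quasi_interior_point M e"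
proof -
  \<comment> \<open>Adding 0 makes the enumerated set nonempty, so that its range is exact even for
    empty \<open>Q\<close>.\<close>
  define v where "v = from_nat_into (insert 0 Q)"
  have range: "range v = insert 0 Q"
    unfolding v_def using Q(1) by (intro range_from_nat_into) auto
  have "0 \<le> q" if "q \<in> insert 0 Q" for q
    using that Q(2) by (auto simp: topological_orthogonal_system_def orthogonal_system_def)
  then have pos: "0 \<le> v n" for n using range by blast
  obtain l where l: "0 \<le> l" "\<And>n. \<exists>c\<ge>1. v n \<le> c *\<^sub>R l"
    using dominating_element[of M v, OF M met complete pos] by blast
  have "Q \<subseteq> order_ideal hull {l}"
  proof
    fix q assume "q \<in> Q"
    then obtain n where n: "q = v n" using range by blast
    then show "q \<in> order_ideal hull {l}"
      unfolding order_ideal_hull_singleton_iff[OF l(1)] n using l(2)[of n] pos[of n] by simp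
  qed
  then have "order_ideal hull Q \<subseteq> order_ideal hull {l}"
    by (rule hull_minimal) (rule order_ideal_hull)
  then have "m_topology M closure_of (order_ideal hull Q) \<subseteq>
      m_topology M closure_of (order_ideal hull {l})"
    by (rule closure_of_mono)
  then have "m_topology M closure_of (order_ideal hull {l}) = UNIV"
    using Q(2) by (simp add: topological_orthogonal_system_def top.extremum_unique)
  then have "quasi_interior_point M l"
    by (rule quasi_interior_pointI[OF nontrivial M l(1)])
  then show ?thesis ..
qed

lemma topological_orthogonal_system_singleton:
  "quasi_interior_point M e \<Longrightarrow> topological_orthogonal_system M {e}"
  by (auto simp: quasi_interior_point_def topological_orthogonal_system_def orthogonal_system_def)

section \<open>Truncation at a quasi-interior point and the um-metric\<close>

text \<open>Density supplies \<open>v\<close> in the ideal of \<open>e\<close> with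
  \<open>m (v - u) < \<epsilon>\<close>, and \<open>inf_le_scaled_inf_add\<close> does the rest. The
  constant depends on \<open>m\<close>, \<open>u\<close> and \<open>\<epsilon>\<close> but not on
  \<open>x\<close>, so um-neighbourhoods given by \<open>u\<close> contain ones given by
  \<open>e\<close>.\<close>

lemma quasi_interior_point_dominates:
  fixes M :: "('a::vector_lattice \<Rightarrow> real) set"
  assumes M: "mnvl M" and e: "quasi_interior_point M e" and m: "m \<in> M"
    and u: "0 \<le> u" and "0 < \<epsilon>"
  shows "\<exists>c\<ge>1. \<forall>x. m (inf \<bar>x\<bar> u) \<le> c * m (inf \<bar>x\<bar> e) + \<epsilon>"
proof -
  note sn = mnvl_seminorm[OF M m]
  have e0: "0 \<le> e" using e by (simp add: quasi_interior_point_def)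
  obtain v where v: "v \<in> order_ideal hull {e}" "m (v - u) < \<epsilon>"
    using e m \<open>0 < \<epsilon>\<close> unfolding quasi_interior_point_def dense_m_topology_iff[OF M] by blast
  obtain c where c: "1 \<le> c" "\<bar>v\<bar> \<le> c *\<^sub>R e"
    using v(1) unfolding order_ideal_hull_singleton_iff[OF e0] by blast
  show ?thesis
  proof (intro exI[of _ c] conjI allI)
    fix x
    have "m (inf \<bar>x\<bar> u) \<le> m (c *\<^sub>R inf \<bar>x\<bar> e + \<bar>u - v\<bar>)"
      by (intro lattice_seminorm_mono_pos[OF sn] inf_le_scaled_inf_add[OF _ e0 c]) (simp_all add: u)
    also have "\<dots> \<le> m (c *\<^sub>R inf \<bar>x\<bar> e) + m \<bar>u - v\<bar>" by (rule lattice_seminorm_triangle[OF sn])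
    also have "m (c *\<^sub>R inf \<bar>x\<bar> e) = c * m (inf \<bar>x\<bar> e)"
      using c by (simp add: lattice_seminorm_scale[OF sn])
    also have "m \<bar>u - v\<bar> \<le> \<epsilon>"
      using v(2) lattice_seminorm_abs[OF sn, of "u - v"] lattice_seminorm_minus[OF sn, of "u - v"]
      by simp
    finally show "m (inf \<bar>x\<bar> u) \<le> c * m (inf \<bar>x\<bar> e) + \<epsilon>" by simp
  qed (rule c)
qed

text \<open>Truncating \<open>z\<close> at \<open>u = \<bar>z\<bar>\<close> changes nothing but the
  sign, so domination by \<open>e\<close> gives \<open>m z \<le> \<epsilon>\<close> for all positive
  \<open>\<epsilon>\<close>. This is what makes the um-metric separate points.\<close>

lemma quasi_interior_point_inf_eq_0:
  fixes M :: "('a::vector_lattice \<Rightarrow> real) set"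
  assumes M: "mnvl M" and e: "quasi_interior_point M e" and "inf \<bar>z\<bar> e = 0"
  shows "z = 0"
proof (rule mnvl_eq_0[OF M])
  fix m assume m: "m \<in> M"
  note sn = mnvl_seminorm[OF M m]
  have "m z \<le> 0 + \<epsilon>" if \<epsilon>: "0 < \<epsilon>" for \<epsilon>
  proof -
    obtain c where "1 \<le> c" and c: "\<And>x. m (inf \<bar>x\<bar> \<bar>z\<bar>) \<le> c * m (inf \<bar>x\<bar> e) + \<epsilon>"
      using quasi_interior_point_dominates[OF M e m abs_ge_zero[of z] \<epsilon>] by blast
    show ?thesis
      using c[of z] assms(3) lattice_seminorm_abs[OF sn, of z] lattice_seminorm_zero[OF sn] by simp
  qed
  then have "m z \<le> 0" by (rule field_le_epsilon)
  then show "m z = 0" using lattice_seminorm_nonneg[OF sn] by (simp add: antisym)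
qed

lemma openin_um_topologyE:
  assumes M: "mnvl M" and U: "openin (um_topology M) U" "x \<in> U"
  obtains m u \<epsilon> where "m \<in> M" "0 \<le> u" "u \<noteq> 0" "0 < \<epsilon>" "{y. m (inf \<bar>y - x\<bar> u) < \<epsilon>} \<subseteq> U"
proof -
  obtain V where V: "V \<in> um_base M" "(+) x ` V \<subseteq> U"
    using bspec[OF U(1)[unfolded openin_um_topology[OF M]] U(2)] by (elim bexE)
  obtain m u \<epsilon> where *: "V = {x. m (inf \<bar>x\<bar> u) < \<epsilon>}" "m \<in> M" "0 \<le> u" "u \<noteq> 0" "0 < \<epsilon>"
    using V(1) unfolding um_base_def by blast
  show ?thesis
  proof (rule that[OF *(2-5)], clarify)
    fix y assume "m (inf \<bar>y - x\<bar> u) < \<epsilon>"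
    then have "x + (y - x) \<in> (+) x ` V" unfolding *(1) by (intro imageI) simp
    then show "y \<in> U" using V(2) by auto
  qed
qed

lemma metrizable_um_topology:
  fixes M :: "('a::vector_lattice \<Rightarrow> real) set"
  assumes M: "mnvl M" and met: "metrizable_space (m_topology M)"
    and e: "quasi_interior_point M e"
  shows "metrizable_space (um_topology M)"
proof -
  obtain p :: "nat \<Rightarrow> 'a \<Rightarrow> real" where p: "\<And>k. p k \<in> M"
    and cofinal: "\<And>m. m \<in> M \<Longrightarrow> \<exists>k. \<exists>C>0. \<forall>x. m x \<le> C * p k x"
    using cofinal_seminorm_sequence[OF M met] by blast
  note sn = mnvl_seminorm[OF M]
  have e0: "0 \<le> e" "e \<noteq> 0" using e by (simp_all add: quasi_interior_point_def)
  define q where "q k x = p k (inf \<bar>x\<bar> e)" for k x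
  \<comment> \<open>The usual metric for countably many seminorm-like functions: the cap at 1 and
    the geometric weights force summability.\<close>
  define f where "f x k = (1/2) ^ k * min 1 (q k x)" for x and k :: nat
  define d where "d x y = suminf (f (x - y))" for x y
  have q_nonneg: "0 \<le> q k x" for k x
    unfolding q_def by (rule lattice_seminorm_nonneg[OF sn[OF p]])
  have f_nonneg: "0 \<le> f x k" for x k by (simp add: f_def q_nonneg)
  have f_le: "f x k \<le> (1/2) ^ k" for x k
    by (simp add: f_def mult_left_le)
  have geometric: "summable (\<lambda>k. (1/2) ^ k :: real)" by (rule summable_geometric) simp
  have summ: "summable (f x)" for x
    by (rule summable_comparison_test'[OF geometric, of 0]) (simp add: f_nonneg f_le)
  have f_le_d: "f (x - y) k \<le> d x y" for x y k
    unfolding d_def using sum_le_suminf[OF summ, of "{k}"] f_nonneg by simp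
  interpret d: Metric_space UNIV d
  proof
    fix x y z :: 'a
    show "0 \<le> d x y" unfolding d_def by (intro suminf_nonneg summ f_nonneg)
    show "d x y = d y x" by (simp add: d_def f_def[abs_def] q_def abs_minus_commute)
    show "d x y = 0 \<longleftrightarrow> x = y"
    proof
      assume "x = y"
      then show "d x y = 0"
        using e0 lattice_seminorm_zero[OF sn[OF p]]
        by (simp add: d_def f_def[abs_def] q_def inf_absorb1)
    next
      assume "d x y = 0"
      then have f0: "f (x - y) k = 0" for k using f_le_d[of x y k] f_nonneg[of "x - y" k] by simp
      have q0: "q k (x - y) = 0" for k
        using f0[of k] by (auto simp: f_def min_def split: if_splits)
      have "inf \<bar>x - y\<bar> e = 0"
      proof (rule mnvl_eq_0[OF M])
        fix m assume m: "m \<in> M"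
        obtain k C where "m (inf \<bar>x - y\<bar> e) \<le> C * p k (inf \<bar>x - y\<bar> e)" using cofinal[OF m] by blast
        then show "m (inf \<bar>x - y\<bar> e) = 0"
          using q0[of k] lattice_seminorm_nonneg[OF sn[OF m], of "inf \<bar>x - y\<bar> e"]
          by (simp add: q_def)
      qed
      then show "x = y" using quasi_interior_point_inf_eq_0[OF M e, of "x - y"] by simp
    qed
    have "f (x - z) k \<le> f (x - y) k + f (y - z) k" for k
    proof -
      have "q k (x - z) \<le> q k (x - y) + q k (y - z)"
        using um_seminorm_triangle[OF sn[OF p] e0(1), of k "x - y" "y - z"] by (simp add: q_def)
      then have "min 1 (q k (x - z)) \<le> min 1 (q k (x - y)) + min 1 (q k (y - z))"
        using q_nonneg[of k "x - y"] q_nonneg[of k "y - z"] by (simp add: min_def)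
      then show ?thesis unfolding f_def distrib_left[symmetric] by (intro mult_left_mono) auto
    qed
    then show "d x z \<le> d x y + d y z"
      unfolding d_def suminf_add[OF summ summ] by (intro suminf_le summ summable_add)
  qed
  have d_small: "\<exists>m\<in>M. \<forall>x y. m (inf \<bar>y - x\<bar> e) < r / 8 \<longrightarrow> d x y < r" if r0: "0 < r" for r
  proof -
    \<comment> \<open>The tail beyond \<open>N\<close> is at most
      \<open>2 * (1/2) ^ N < r / 2\<close>. One \<open>m\<close> dominating the first
      \<open>N\<close> seminorms bounds the head by twice its value, which is below
      \<open>r / 4\<close>.\<close>
    obtain N where N: "(1/2) ^ N < r / 4" using real_arch_pow_inv[of "r / 4" "1/2"] r0 by auto
    obtain m where m: "m \<in> M" "\<And>k x. k < N \<Longrightarrow> p k x \<le> m x"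
      using mnvl_directed_lessThan[of M p N, OF M p] by blast
    have "d x y < r" if xy: "m (inf \<bar>y - x\<bar> e) < r / 8" for x y
    proof -
      have half: "(\<Sum>k. (1/2) ^ k) = (2::real)" using suminf_geometric[of "1/2::real"] by simp
      have "d x y = (\<Sum>k. f (x - y) (k + N)) + (\<Sum>k<N. f (x - y) k)"
        unfolding d_def by (rule suminf_split_initial_segment[OF summ])
      also have "(\<Sum>k. f (x - y) (k + N)) \<le> (\<Sum>k. (1/2) ^ N * (1/2) ^ k)"
        using f_le[of "x - y" "_ + N"]
        by (intro suminf_le summable_mult geometric summable_ignore_initial_segment summ)
           (simp add: power_add mult.commute)
      also have "\<dots> = 2 * (1/2) ^ N" using half by (simp add: suminf_mult[OF geometric])
      also have "(\<Sum>k<N. f (x - y) k) \<le> (\<Sum>k<N. (1/2) ^ k * m (inf \<bar>y - x\<bar> e))"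
        unfolding f_def using m(2)
        by (intro sum_mono mult_left_mono) (auto simp: q_def abs_minus_commute min.coboundedI2)
      also have "\<dots> = (\<Sum>k<N. (1/2) ^ k) * m (inf \<bar>y - x\<bar> e)" by (simp add: sum_distrib_right)
      also have "\<dots> \<le> 2 * m (inf \<bar>y - x\<bar> e)"
        using sum_le_suminf[OF geometric, of "{..<N}"] half
        by (intro mult_right_mono lattice_seminorm_nonneg[OF sn[OF m(1)]]) simp
      finally have "d x y \<le> 2 * (1/2) ^ N + 2 * m (inf \<bar>y - x\<bar> e)" by simp
      then show ?thesis using N xy r0 by linarith
    qed
    then show ?thesis using m(1) by blast
  qed
  have "openin (um_topology M) U \<longleftrightarrow> openin d.mtopology U" for U
  proof
    assume U: "openin (um_topology M) U"
    show "openin d.mtopology U"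
      unfolding d.openin_mtopology
    proof (intro conjI allI impI)
      fix x assume "x \<in> U"
      obtain m u \<epsilon> where m: "m \<in> M" "0 \<le> u" "u \<noteq> 0" "0 < \<epsilon>"
        and ball: "{y. m (inf \<bar>y - x\<bar> u) < \<epsilon>} \<subseteq> U"
        by (rule openin_um_topologyE[OF M U \<open>x \<in> U\<close>])
      have "0 < \<epsilon> / 2" using m by simp
      then obtain c where c: "1 \<le> c" "\<And>x. m (inf \<bar>x\<bar> u) \<le> c * m (inf \<bar>x\<bar> e) + \<epsilon> / 2"
        using quasi_interior_point_dominates[OF M e m(1,2)] by blast
      obtain k C where C: "0 < C" "\<And>x. m x \<le> C * p k x" using cofinal[OF m(1)] by blast
      \<comment> \<open>The power undoes the weight of the \<open>k\<close>-th term, and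
        \<open>min 1\<close> forces the cap in \<open>f\<close> to be inactive. Then
        \<open>q k (x - y) < \<epsilon> / (2 * c * C)\<close>, which leaves
        \<open>\<epsilon> / 2\<close> for the error in the domination by \<open>e\<close>.\<close>
      define r where "r = (1/2) ^ k * min 1 (\<epsilon> / (2 * c * C))"
      have "0 < r" using m c C by (simp add: r_def)
      moreover have "d.mball x r \<subseteq> U"
      proof
        fix y assume "y \<in> d.mball x r"
        then have "f (x - y) k < r" using f_le_d[of x y k] by simp
        then have "q k (x - y) < \<epsilon> / (2 * c * C)"
          unfolding f_def r_def by (simp add: min_def split: if_splits)
        then have "c * (C * q k (x - y)) < \<epsilon> / 2" using c C by (simp add: field_simps)
        moreover have "m (inf \<bar>y - x\<bar> e) \<le> C * q k (x - y)"
          using C(2) by (simp add: q_def abs_minus_commute)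
        then have "c * m (inf \<bar>y - x\<bar> e) \<le> c * (C * q k (x - y))"
          using c by (intro mult_left_mono) auto
        ultimately show "y \<in> U" using c(2)[of "y - x"] by (intro subsetD[OF ball]) simp
      qed
      ultimately show "\<exists>r>0. d.mball x r \<subseteq> U" by blast
    qed simp
  next
    assume U: "openin d.mtopology U"
    show "openin (um_topology M) U"
      unfolding openin_um_topology[OF M]
    proof
      fix x assume "x \<in> U"
      then obtain r where r: "0 < r" "d.mball x r \<subseteq> U"
        using U unfolding d.openin_mtopology by blast
      obtain m where m: "m \<in> M" "\<And>x y. m (inf \<bar>y - x\<bar> e) < r / 8 \<Longrightarrow> d x y < r"
        using d_small[OF r(1)] by blast
      have "{v. m (inf \<bar>v\<bar> e) < r / 8} \<in> um_base M"
        using um_baseI[of m M e "r / 8", OF m(1) e0] r(1) by simp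
      moreover have "(+) x ` {v. m (inf \<bar>v\<bar> e) < r / 8} \<subseteq> U"
        using m(2)[of "x + _" x] r(2) by auto
      ultimately show "\<exists>V\<in>um_base M. (+) x ` V \<subseteq> U" by blast
    qed
  qed
  then have "um_topology M = d.mtopology" by (simp add: topology_eq)
  then show ?thesis using d.metrizable_space_mtopology by simp
qed

text \<open>The vectors \<open>(y - n u)\<^sup>+\<close> are um-null along the countable base at zero dominated by \<open>u\<close>;
  testing um-convergence against \<open>y\<close> itself makes them m-null.\<close>

lemma quasi_interior_point_of_metrizable:
  fixes M :: "('a::vector_lattice \<Rightarrow> real) set"
  assumes nontrivial: "\<exists>x::'a. x \<noteq> 0" and M: "mnvl M"
    and met: "metrizable_space (m_topology M)"
    and complete: "complete_linear_topology (m_topology M)"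
    and um: "metrizable_space (um_topology M)"
  shows "\<exists>e. quasi_interior_point M e"
proof -
  note sn = mnvl_seminorm[OF M]
  \<comment> \<open>A constant sequence um-converges, which places 0 in the carrier of the
    um-topology.\<close>
  have "limitin (um_topology M) (\<lambda>_. 0) 0 (sequentially :: nat filter)"
    unfolding limitin_um_topology[OF M nontrivial]
    by (auto simp: inf_absorb1 lattice_seminorm_zero[OF sn])
  then have "0 \<in> topspace (um_topology M)" by (simp add: limitin_def)
  with metrizable_imp_first_countable[OF um]
  obtain V :: "nat \<Rightarrow> 'a set" where V: "\<And>n. openin (um_topology M) (V n)" "\<And>n. 0 \<in> V n"
    "\<And>U. openin (um_topology M) U \<Longrightarrow> 0 \<in> U \<Longrightarrow> \<exists>n. V n \<subseteq> U"
    by (rule first_countable_nbhd_sequence) blast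
  have "\<exists>m u \<epsilon>. m \<in> M \<and> 0 \<le> u \<and> 0 < \<epsilon> \<and> (\<forall>y. m (inf \<bar>y\<bar> u) < \<epsilon> \<longrightarrow> y \<in> V n)" for n
  proof -
    obtain m u \<epsilon> where "m \<in> M" "0 \<le> u" "u \<noteq> 0" "0 < \<epsilon>"
      "{y. m (inf \<bar>y - 0\<bar> u) < \<epsilon>} \<subseteq> V n"
      by (rule openin_um_topologyE[OF M V(1,2)])
    then show ?thesis by auto
  qed
  then obtain m u \<epsilon> where m: "\<And>n. m n \<in> M" and u: "\<And>n. 0 \<le> u n" and \<epsilon>: "\<And>n. 0 < (\<epsilon> n :: real)"
    and ball: "\<And>n y. m n (inf \<bar>y\<bar> (u n)) < \<epsilon> n \<Longrightarrow> y \<in> V n"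
    by metis
  obtain l where l: "0 \<le> l" "\<And>n. \<exists>c\<ge>1. u n \<le> c *\<^sub>R l"
    using dominating_element[of M u, OF M met complete u] by blast
  have approx: "\<exists>z\<in>order_ideal hull {l}. m' (z - y) < r" if y: "0 \<le> y" and m': "m' \<in> M" and r: "0 < r"
    for y m' r
  proof -
    \<comment> \<open>\<open>Suc n\<close> keeps the factor at least 1, as both
      \<open>inf_pprt_diff_le\<close> and the description of the principal ideal require.\<close>
    define x where "x n = pprt (y - real (Suc n) *\<^sub>R l)" for n
    have x0: "0 \<le> x n" for n by (simp add: x_def)
    have xy: "x n \<le> y" for n
      using y l(1) by (simp add: x_def pprt_def scaleR_nonneg_nonneg)
    have "limitin (um_topology M) x 0 sequentially"
      unfolding limitin_def
    proof (intro conjI allI impI)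
      fix U assume U: "openin (um_topology M) U \<and> 0 \<in> U"
      then obtain k where k: "V k \<subseteq> U" using V(3) by blast
      obtain c where c: "1 \<le> c" "u k \<le> c *\<^sub>R l" using l(2) by blast
      \<comment> \<open>Truncation of \<open>x n\<close> at \<open>l\<close> decays like
        \<open>y / (n + 1)\<close> by \<open>inf_pprt_diff_le\<close>; passing from \<open>l\<close>
        to \<open>u k\<close> costs only the factor \<open>c\<close>.\<close>
      have bound: "m k (inf \<bar>x n\<bar> (u k)) \<le> c * m k y * inverse (real (Suc n))" for n
      proof -
        have "real (Suc n) *\<^sub>R inf (x n) l \<le> y"
          unfolding x_def using y l(1) by (intro inf_pprt_diff_le) auto
        then have "m k (real (Suc n) *\<^sub>R inf (x n) l) \<le> m k y"
          using x0 l(1) by (intro lattice_seminorm_mono_pos sn m scaleR_nonneg_nonneg) auto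
        then have le: "m k (inf (x n) l) \<le> m k y * inverse (real (Suc n))"
          unfolding lattice_seminorm_scale[OF sn[OF m]] by (simp add: field_simps)
        have "inf (x n) (u k) \<le> inf (x n) (c *\<^sub>R l)" using c by (intro inf_mono) auto
        also have "\<dots> \<le> c *\<^sub>R inf (x n) l" by (rule inf_scaleR_le[OF x0 c(1)])
        finally have "m k (inf (x n) (u k)) \<le> m k (c *\<^sub>R inf (x n) l)"
          using x0 u by (intro lattice_seminorm_mono_pos sn m) auto
        also have "\<dots> = c * m k (inf (x n) l)"
          using c by (simp add: lattice_seminorm_scale[OF sn[OF m]])
        also have "\<dots> \<le> c * (m k y * inverse (real (Suc n)))"
          using c by (intro mult_left_mono le) auto
        finally show ?thesis using x0 by (simp add: mult.assoc)
      qed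
      have "(\<lambda>n. c * m k y * inverse (real (Suc n))) \<longlonglongrightarrow> c * m k y * 0"
        by (intro tendsto_mult_left LIMSEQ_inverse_real_of_nat)
      then have "eventually (\<lambda>n. c * m k y * inverse (real (Suc n)) < \<epsilon> k) sequentially"
        using \<epsilon> by (auto dest: order_tendstoD(2))
      then show "eventually (\<lambda>n. x n \<in> U) sequentially"
        by eventually_elim (use k ball bound le_less_trans in blast)
    qed fact
    then have "(\<lambda>n. m' (inf \<bar>x n - 0\<bar> y)) \<longlonglongrightarrow> 0"
      unfolding limitin_um_topology[OF M nontrivial] using y m' by blast
    then have "(\<lambda>n. m' (x n)) \<longlonglongrightarrow> 0" using x0 xy by (simp add: inf_absorb1)
    then have "eventually (\<lambda>n. m' (x n) < r) sequentially" using r by (rule order_tendstoD(2))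
    then obtain n where n: "m' (x n) < r" by (auto simp: eventually_sequentially)
    \<comment> \<open>Removing the excess over \<open>real (Suc n) *\<^sub>R l\<close> leaves a
      truncation of \<open>y\<close>, which lies in the ideal of \<open>l\<close> and differs from
      \<open>y\<close> by exactly \<open>x n\<close>.\<close>
    have "y - x n = inf (real (Suc n) *\<^sub>R l) y"
      unfolding x_def pprt_def diff_sup_eq_inf by (simp add: add_inf_distrib_left)
    then have "y - x n \<le> real (Suc n) *\<^sub>R l" by simp
    then have "\<bar>y - x n\<bar> \<le> real (Suc n) *\<^sub>R l"
      using xy[of n] by (subst abs_of_nonneg) simp_all
    then have "y - x n \<in> order_ideal hull {l}"
      unfolding order_ideal_hull_singleton_iff[OF l(1)] by (intro exI[of _ "real (Suc n)"]) simp
    moreover have "m' (y - x n - y) < r" using n by (simp add: lattice_seminorm_minus[OF sn[OF m']])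
    ultimately show ?thesis by blast
  qed
  have "m_topology M closure_of (order_ideal hull {l}) = UNIV"
    unfolding dense_m_topology_iff[OF M]
  proof (intro allI ballI impI)
    fix x :: 'a and m' and r :: real assume m': "m' \<in> M" and "0 < r"
    then have r: "0 < r / 2" by simp
    \<comment> \<open>\<open>approx\<close> covers positive vectors only, so the positive and
      negative parts of \<open>x\<close> are approximated separately, each within
      \<open>r / 2\<close>.\<close>
    obtain a where a: "a \<in> order_ideal hull {l}" "m' (a - pprt x) < r / 2"
      using approx[OF zero_le_pprt m' r] by blast
    obtain b where b: "b \<in> order_ideal hull {l}" "m' (b - pprt (- x)) < r / 2"
      using approx[OF zero_le_pprt m' r] by blast
    have "a - b \<in> order_ideal hull {l}"
      using order_ideal_hull[of "{l}"] a(1) b(1) unfolding order_ideal_def by (blast intro: subspace_diff)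
    moreover have eq: "a - b - x = (a - pprt x) + - (b - pprt (- x))"
      by (subst (1) prts[of x]) (simp add: pprt_neg)
    have "m' (a - b - x) < r"
      unfolding eq using a(2) b(2) lattice_seminorm_triangle[OF sn[OF m'], of "a - pprt x" "- (b - pprt (- x))"]
        lattice_seminorm_minus[OF sn[OF m'], of "b - pprt (- x)"] by linarith
    ultimately show "\<exists>z\<in>order_ideal hull {l}. m' (z - x) < r" by blast
  qed
  then show ?thesis using quasi_interior_pointI[OF nontrivial M l(1)] by blast
qed

theorem proposition4:
  fixes M :: "('a::vector_lattice \<Rightarrow> real) set"
  assumes nontrivial: "\<exists>x::'a. x \<noteq> 0"
    and mnvl: "mnvl M"
    and metrizable: "metrizable_space (m_topology M)"
    and complete: "complete_linear_topology (m_topology M)"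
  shows "((\<exists>Q. countable Q \<and> topological_orthogonal_system M Q) \<longleftrightarrow>
            metrizable_space (um_topology M)) \<and>
         (metrizable_space (um_topology M) \<longleftrightarrow> (\<exists>e. quasi_interior_point M e))"
proof -
  \<comment> \<open>For the direction from right to left, a quasi-interior point alone forms a
    one-element topological orthogonal system.\<close>
  have "(\<exists>Q. countable Q \<and> topological_orthogonal_system M Q) \<longleftrightarrow> (\<exists>e. quasi_interior_point M e)"
    using quasi_interior_point_of_topological_orthogonal_system[OF assms]
      topological_orthogonal_system_singleton countable_finite by blast
  moreover have "metrizable_space (um_topology M) \<longleftrightarrow> (\<exists>e. quasi_interior_point M e)"
    using metrizable_um_topology[OF mnvl metrizable] quasi_interior_point_of_metrizable[OF assms]
    by blast
  ultimately show ?thesis by simp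
qed

end
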